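(* Let $i\in\{0,1,2,\dots\}$, let $x_0,\hat x_0\in[l,r)$, and put $x_i=\max(x_0,\hat x_0)$. Let $P_i$ and $P_{i+1}=-f\,P_i/P_i'$ be the iterates defined in the context. (i) If $P_i$ is an upper bound on $1-F$ on $(x_0,r)$ in the sense of the context, and $P_i'(x)<0$ for all $x\in(\hat x_0,r)$, then $$P_{i+1}(x)\le P_i(x)\qquad\text{for all }x\in(x_i,r).$$ (ii) If $P_i$ is a lower bound on $1-F$ on $(x_0,r)$ in the sense of the context, and $P_i'(x)<0$ for all $x\in(\hat x_0,r)$, then $$P_{i+1}(x)\ge P_i(x)\qquad\text{for all }x\in(x_i,r).$$
   Context: $X$ is a continuous real random variable with cumulative distribution function $F(x)=\Pr\{X\le x\}$ and probability density function $f(x)=F'(x)$. The support of $f$ is an interval with endpoints $l$ and $r$, $-\infty\le l<r\le\infty$, each endpoint being included or not. The density $f$ is continuous on the support and its derivative $f'$ exists there; all functions are assumed differentiable as often as needed for the expressions below to make sense. Given a function $g$, the iterates are $$P_0(x)=-f(x)\frac{g(x)}{g'(x)},\qquad P_{i+1}(x)=-f(x)\frac{P_i(x)}{P_i'(x)},\quad i=0,1,2,\dots$$ Put $g_0=g$ and $g_i=P_{i-1}$ for $i\ge1$, so that $P_i=-f\,g_i/g_i'$. "$P_i$ is an upper (respectively lower) bound on $1-F$ on $(x_0,r)$" means that it is obtained as such from the following criterion: $g_i$ is continuous, positive and strictly decreasing on $(x_0,r)$ with $g_i'(x)<0$ there, $\lim_{x\to r}P_i(x)=0$, and $P_i'(x)+f(x)\le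 0$ (respectively $P_i'(x)+f(x)\ge 0$) for all $x\in(x_0,r)$; consequently $1-F(x)\le P_i(x)$ (respectively $1-F(x)\ge P_i(x)$) for all $x\in(x_0,r)$. *)

theory Defs
  imports "HOL-Probability.Probability"
begin

text \<open>
  The support is the set of points where the density is nonzero, so that it need not be
  closed; \<open>l\<close> and \<open>r\<close> are its possibly infinite endpoints.  Differentiability relative to the
  support is one-sided at an endpoint that belongs to it.
\<close>

locale continuous_random_variable = prob_space M
  for M :: "'a measure" +
  fixes X :: "'a \<Rightarrow> real" and f :: "real \<Rightarrow> real" and l r :: ereal
  assumes density: "distributed M lborel X (\<lambda>x. ennreal (f x))"
    and density_nonneg: "\<And>x. 0 \<le> f x"
    and cdf_deriv: "\<And>x. x \<in> support_on UNIV f \<Longrightarrow>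
          (cdf (distr M borel X) has_real_derivative f x) (at x within support_on UNIV f)"
    and support_interval: "is_interval (support_on UNIV f)"
    and left_endpoint: "l = (INF x\<in>support_on UNIV f. ereal x)"
    and right_endpoint: "r = (SUP x\<in>support_on UNIV f. ereal x)"
    and endpoints_less: "l < r"
    and density_continuous: "continuous_on (support_on UNIV f) f"
    and density_differentiable: "f differentiable_on support_on UNIV f"

primrec bound_iter :: "(real \<Rightarrow> real) \<Rightarrow> (real \<Rightarrow> real) \<Rightarrow> nat \<Rightarrow> real \<Rightarrow> real" where
  "bound_iter f g 0 = (\<lambda>x. - f x * (g x / deriv g x))"
| "bound_iter f g (Suc i) = (\<lambda>x. - f x * (bound_iter f g i x / deriv (bound_iter f g i) x))"

definition g_seq :: "(real \<Rightarrow> real) \<Rightarrow> (real \<Rightarrow> real) \<Rightarrow> nat \<Rightarrow> real \<Rightarrow> real" where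
  "g_seq f g i = (case i of 0 \<Rightarrow> g | Suc j \<Rightarrow> bound_iter f g j)"

lemma bound_iter_eq_g_seq: "bound_iter f g i x = - f x * (g_seq f g i x / deriv (g_seq f g i) x)"
  by (cases i) (simp_all add: g_seq_def)

text \<open>
  Since \<^const>\<open>deriv\<close> is unspecified at points of non-differentiability, differentiability is
  required wherever a condition refers to a derivative.  The composition with
  \<^const>\<open>real_of_ereal\<close> expresses the limit at a finite or infinite right endpoint.
\<close>

definition bound_criterion ::
    "(real \<Rightarrow> real) \<Rightarrow> (real \<Rightarrow> real) \<Rightarrow> ereal \<Rightarrow> nat \<Rightarrow> ereal \<Rightarrow> bool" where
  "bound_criterion f g r i x0 \<longleftrightarrow>
     continuous_on (einterval x0 r) (g_seq f g i) \<and>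
     (\<forall>x\<in>einterval x0 r. 0 < g_seq f g i x) \<and>
     strict_antimono_on (einterval x0 r) (g_seq f g i) \<and>
     (\<forall>x\<in>einterval x0 r. g_seq f g i field_differentiable at x \<and> deriv (g_seq f g i) x < 0) \<and>
     ((bound_iter f g i \<circ> real_of_ereal) \<longlongrightarrow> 0) (at_left r) \<and>
     (\<forall>x\<in>einterval x0 r. bound_iter f g i field_differentiable at x)"

definition is_upper_bound ::
    "(real \<Rightarrow> real) \<Rightarrow> (real \<Rightarrow> real) \<Rightarrow> ereal \<Rightarrow> nat \<Rightarrow> ereal \<Rightarrow> bool" where
  "is_upper_bound f g r i x0 \<longleftrightarrow>
     bound_criterion f g r i x0 \<and> (\<forall>x\<in>einterval x0 r. deriv (bound_iter f g i) x + f x \<le> 0)"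

definition is_lower_bound ::
    "(real \<Rightarrow> real) \<Rightarrow> (real \<Rightarrow> real) \<Rightarrow> ereal \<Rightarrow> nat \<Rightarrow> ereal \<Rightarrow> bool" where
  "is_lower_bound f g r i x0 \<longleftrightarrow>
     bound_criterion f g r i x0 \<and> (\<forall>x\<in>einterval x0 r. 0 \<le> deriv (bound_iter f g i) x + f x)"

text \<open>The criteria do yield bounds on the tail \<open>1 - F\<close>:\<close>

context continuous_random_variable
begin

abbreviation F :: "real \<Rightarrow> real" where
  "F \<equiv> cdf (distr M borel X)"

lemma einterval_subset_support: "einterval l r \<subseteq> support_on UNIV f"
proof
  fix x assume x: "x \<in> einterval l r"
  obtain a where a: "a \<in> support_on UNIV f" "a < x"
    using x by (auto simp: einterval_def left_endpoint INF_less_iff)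
  obtain b where b: "b \<in> support_on UNIV f" "x < b"
    using x by (auto simp: einterval_def right_endpoint less_SUP_iff)
  show "x \<in> support_on UNIV f"
    using support_interval a b unfolding is_interval_1 by (meson less_imp_le)
qed

lemma F_deriv:
  assumes "x \<in> einterval l r"
  shows "(F has_real_derivative f x) (at x)"
proof -
  have "(F has_real_derivative f x) (at x within einterval l r)"
    using cdf_deriv[of x] einterval_subset_support assms
    by (meson DERIV_subset subsetD)
  then show ?thesis
    using at_within_open[OF assms] by simp
qed

lemma zero_above: "ereal x > r \<Longrightarrow> f x = 0"
proof (rule ccontr)
  assume x: "ereal x > r" "f x \<noteq> 0"
  then have "ereal x \<le> r"
    unfolding right_endpoint by (intro SUP_upper) (simp add: support_on_def)
  then show False using x by simp
qed

lemma F_tendsto: "((F \<circ> real_of_ereal) \<longlongrightarrow> 1) (at_left r)"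
proof -
  interpret D: real_distribution "distr M borel X"
    using density by (intro real_distribution_distr) (simp add: distributed_def)
  show ?thesis
  proof (cases r)
    case PInf
    then show ?thesis
      using D.cdf_lim_at_top_prob by (simp add: ereal_tendsto_simps)
  next
    case MInf
    then show ?thesis using endpoints_less by simp
  next
    case (real b)
    have D: "distr M borel X = density lborel (\<lambda>x. ennreal (f x))"
      using distributed_distr_eq_density[OF density] by (simp cong: distr_cong)
    have [measurable]: "(\<lambda>x. ennreal (f x)) \<in> borel_measurable lborel"
      using density by (simp add: distributed_def)
    have "emeasure (distr M borel X) {b..} = (\<integral>\<^sup>+x. ennreal (f x) * indicator {b..} x \<partial>lborel)"
      unfolding D by (subst emeasure_density) auto
    also have "\<dots> = (\<integral>\<^sup>+x. 0 \<partial>(lborel :: real measure))"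
    proof (rule nn_integral_cong_AE)
      have "AE x in lborel. x \<noteq> b" by (rule AE_lborel_singleton)
      then show "AE x in lborel. ennreal (f x) * indicator {b..} x = 0"
      proof eventually_elim
        case (elim x)
        then show ?case using zero_above[of x] real by (auto simp: indicator_def)
      qed
    qed
    finally have "measure (distr M borel X) {b..} = 0" by (simp add: measure_def)
    moreover have "measure (distr M borel X) (UNIV - {b..}) = 1 - measure (distr M borel X) {b..}"
      using D.prob_compl[of "{b..}"] by simp
    moreover have "UNIV - {b..} = {..<b}" by auto
    ultimately have "measure (distr M borel X) {..<b} = 1" by simp
    then have "(F \<longlongrightarrow> 1) (at_left b)" using D.cdf_at_left[of b] by simp
    then show ?thesis using real by (simp add: ereal_tendsto_simps)
  qed
qed

lemma bound_aux:
  fixes s :: real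
  assumes x: "x \<in> einterval x0 r" and "l \<le> x0"
    and lim: "((Q \<circ> real_of_ereal) \<longlongrightarrow> 0) (at_left r)"
    and diff: "\<And>y. y \<in> einterval x0 r \<Longrightarrow> Q field_differentiable at y"
    and le: "\<And>y. y \<in> einterval x0 r \<Longrightarrow> s * (deriv Q y + f y) \<le> 0"
  shows "s * (1 - F x) \<le> s * Q x"
proof -
  define h where "h y = s * (1 - F y - Q y)" for y
  have mono: "h x \<le> h y" if y: "x \<le> y" "ereal y < r" for y
  proof (rule DERIV_nonneg_imp_nondecreasing[OF y(1)])
    fix z assume z: "x \<le> z" "z \<le> y"
    have z0: "z \<in> einterval x0 r"
      using z y x by (auto simp: einterval_def intro: less_le_trans le_less_trans
          simp flip: ereal_less_eq(3))
    have zl: "z \<in> einterval l r"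
      using z0 \<open>l \<le> x0\<close> by (auto simp: einterval_def)
    have "(h has_real_derivative s * (0 - f z - deriv Q z)) (at z)"
      unfolding h_def using diff[OF z0] F_deriv[OF zl]
      by (intro DERIV_cmult DERIV_diff DERIV_const) (simp_all add: DERIV_deriv_iff_field_differentiable)
    moreover have "0 \<le> s * (0 - f z - deriv Q z)"
      using le[OF z0] by (simp add: algebra_simps)
    ultimately show "\<exists>D. (h has_real_derivative D) (at z) \<and> 0 \<le> D" by blast
  qed
  have "((\<lambda>e. s * (1 - (F \<circ> real_of_ereal) e - (Q \<circ> real_of_ereal) e)) \<longlongrightarrow> s * (1 - 1 - 0)) (at_left r)"
    by (intro tendsto_intros F_tendsto lim)
  then have lim_h: "((\<lambda>e. h (real_of_ereal e)) \<longlongrightarrow> 0) (at_left r)"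
    by (simp add: h_def)
  have xr: "ereal x < r" using x by (simp add: einterval_def)
  have "eventually (\<lambda>e. e \<in> {ereal x<..<r}) (at_left r)"
    using xr by (auto simp: eventually_at_left[OF xr])
  then have "eventually (\<lambda>e. h x \<le> h (real_of_ereal e)) (at_left r)"
  proof eventually_elim
    case (elim e)
    then show ?case by (cases e) (auto intro!: mono)
  qed
  moreover have "at_left r \<noteq> bot"
    using xr by (cases r) (simp_all add: at_left_ereal at_left_PInf filtermap_bot_iff)
  ultimately have "h x \<le> 0"
    using tendsto_lowerbound[OF lim_h] by blast
  then show ?thesis by (simp add: h_def algebra_simps)
qed

lemma upper_bound:
  assumes "is_upper_bound f g r i x0" "l \<le> x0" "x \<in> einterval x0 r"
  shows "1 - F x \<le> bound_iter f g i x"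
  using bound_aux[OF assms(3,2), of "bound_iter f g i" 1] assms(1)
  by (simp add: is_upper_bound_def bound_criterion_def)

lemma lower_bound:
  assumes "is_lower_bound f g r i x0" "l \<le> x0" "x \<in> einterval x0 r"
  shows "bound_iter f g i x \<le> 1 - F x"
proof -
  have "- 1 * (1 - F x) \<le> - 1 * bound_iter f g i x"
    using assms(1) by (intro bound_aux[OF assms(3,2)])
      (auto simp: is_lower_bound_def bound_criterion_def algebra_simps dest!: bspec)
  then show ?thesis by simp
qed

end

end

theory Submission
  imports Defs
begin

text \<open>
  Both parts compare a single factor with 1, pointwise.  Writing \<open>P = - f * h / h'\<close> for the
  \<open>i\<close>-th iterate, with \<open>h\<close> the \<open>i\<close>-th member of \<^const>\<open>g_seq\<close>, the next iterate is
  \<open>P * (f / (- P'))\<close>, where \<open>- P' > 0\<close>.  The sign of \<open>P' + f\<close> in the bound criterion says on which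
  side of 1 the factor \<open>f / (- P')\<close> lies, and multiplication by \<open>P\<close> preserves that inequality
  (\<open>bound_iter_Suc_le\<close>, \<open>bound_iter_Suc_ge\<close>) because \<open>P \<ge> 0\<close> (\<open>bound_iter_nonneg\<close>): a density
  is nonnegative, and the criterion makes \<open>h\<close> positive and \<open>h'\<close> negative.
\<close>

lemma bound_iter_nonneg:
  assumes "bound_criterion f g r i x0" "x \<in> einterval x0 r" "0 \<le> f x"
  shows "0 \<le> bound_iter f g i x"
proof -
  have "0 < g_seq f g i x" "deriv (g_seq f g i) x < 0"
    using assms by (auto simp: bound_criterion_def)
  then show ?thesis
    using assms(3)
    by (simp add: bound_iter_eq_g_seq mult_nonneg_nonpos divide_nonneg_neg)
qed

lemma bound_iter_Suc_eq_mult_ratio: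
  "bound_iter f g (Suc i) x = bound_iter f g i x * (f x / - deriv (bound_iter f g i) x)"
  by simp

lemma bound_iter_Suc_le:
  assumes "0 \<le> bound_iter f g i x" "deriv (bound_iter f g i) x < 0"
    and "deriv (bound_iter f g i) x + f x \<le> 0"
  shows "bound_iter f g (Suc i) x \<le> bound_iter f g i x"
proof -
  have "f x / - deriv (bound_iter f g i) x \<le> 1"
    using assms by (subst pos_divide_le_eq) auto
  then show ?thesis
    unfolding bound_iter_Suc_eq_mult_ratio using assms(1) by (rule mult_left_le)
qed

lemma bound_iter_Suc_ge:
  assumes "0 \<le> bound_iter f g i x" "deriv (bound_iter f g i) x < 0"
    and "0 \<le> deriv (bound_iter f g i) x + f x"
  shows "bound_iter f g i x \<le> bound_iter f g (Suc i) x"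
proof -
  have "1 \<le> f x / - deriv (bound_iter f g i) x"
    using assms by (subst pos_le_divide_eq) auto
  from mult_left_mono[OF this assms(1)] show ?thesis
    unfolding bound_iter_Suc_eq_mult_ratio by simp
qed

theorem lemma4:
  fixes M :: "'a measure" and X :: "'a \<Rightarrow> real" and f g :: "real \<Rightarrow> real"
    and l r x0 x0_hat :: ereal and i :: nat
  assumes "continuous_random_variable M X f l r"
    and "x0 \<in> {l..<r}" and "x0_hat \<in> {l..<r}"
  shows
    "(is_upper_bound f g r i x0 \<and>
        (\<forall>x\<in>einterval x0_hat r. bound_iter f g i field_differentiable at x \<and> deriv (bound_iter f g i) x < 0) \<longrightarrow>
        (\<forall>x\<in>einterval (max x0 x0_hat) r. bound_iter f g (Suc i) x \<le> bound_iter f g i x))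
   \<and> (is_lower_bound f g r i x0 \<and>
        (\<forall>x\<in>einterval x0_hat r. bound_iter f g i field_differentiable at x \<and> deriv (bound_iter f g i) x < 0) \<longrightarrow>
        (\<forall>x\<in>einterval (max x0 x0_hat) r. bound_iter f g (Suc i) x \<ge> bound_iter f g i x))"
proof -
  have f: "0 \<le> f x" for x
    using assms(1) by (rule continuous_random_variable.density_nonneg)
  have mem: "x \<in> einterval x0 r" "x \<in> einterval x0_hat r"
    if "x \<in> einterval (max x0 x0_hat) r" for x
    using that by (auto simp: einterval_def)
  show ?thesis
    unfolding is_upper_bound_def is_lower_bound_def
    by (intro conjI impI ballI)
      (blast intro: bound_iter_Suc_le bound_iter_Suc_ge bound_iter_nonneg f dest: mem)+
qed

end
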